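(* Assume $\mathrm{cov}(\mathcal{B}) = 2^{\aleph_0}$. Then, for every integer $n > 1$, there exists a set of reals $E \subseteq \mathbb{R}$ which is $(2^{\aleph_0},n)$-entangled but not $(2^{\aleph_0},n+1)$-entangled.
   Context: $\mathrm{cov}(\mathcal{B})$ is the least cardinal $\kappa$ such that $\mathbb{R}$ (equivalently any perfect Polish space) is a union of $\kappa$ meager sets. Sets of reals carry the usual order. For two $m$-tuples $e,e'$ of reals, let $t(e,e') \in {}^m 2$ be defined by $t(e,e')_i = 1$ iff $e'_i < e_i$. For $t \in {}^m2$ let $\neg t = \langle 1-t_i \mid i<m\rangle$. Two $m$-tuples $e,e'$ realize $t$ if $t(e,e') = t$ or $t(e,e') = \neg t$. A tuple is 1-1 if its entries are pairwise distinct; two tuples are disjoint if they have no entry in common. For an infinite cardinal $\kappa$ and integer $m>0$, a set $E$ is $(\kappa,m)$-entangled if $|E| \ge \kappa$ and for every collection $F$ of size $\kappa$ of 1-1, mutually disjoint $m$-tuples of elements of $E$ and every $t \in {}^m2$, there are two distinct elements of $F$ that realize $t$. *)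

theory Defs
  imports "HOL-Analysis.Analysis"
begin

unbundle cardinal_syntax

definition nowhere_dense :: "'a::topological_space set \<Rightarrow> bool" where
  "nowhere_dense A \<longleftrightarrow> interior (closure A) = {}"

definition meager :: "'a::topological_space set \<Rightarrow> bool" where
  "meager A \<longleftrightarrow> (\<exists>\<N>. countable \<N> \<and> (\<forall>N\<in>\<N>. nowhere_dense N) \<and> A = \<Union>\<N>)"

definition meager_covering :: "real set set \<Rightarrow> bool" where
  "meager_covering \<C> \<longleftrightarrow> (\<forall>A\<in>\<C>. meager A) \<and> \<Union>\<C> = (UNIV :: real set)"

(* Cardinals are represented as in the BNF cardinal library, by wellorders up to order
   isomorphism =o. The choice below is therefore immaterial up to =o; the two lemmas after
   the definition show that the required minimal covering exists. *)
definition cov_B :: "real set rel" where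
  "cov_B = (SOME r. \<exists>\<C>. meager_covering \<C> \<and> r = |\<C>| \<and>
                        (\<forall>\<D>. meager_covering \<D> \<longrightarrow> r \<le>o |\<D>| ))"

lemma meager_covering_singletons: "meager_covering (range (\<lambda>x. {x}))"
proof -
  have "meager {x}" for x :: real
    unfolding meager_def by (rule exI[of _ "{{x}}"]) (simp add: nowhere_dense_def)
  then show ?thesis
    by (auto simp: meager_covering_def)
qed

lemma cov_B_least:
  "\<exists>\<C>. meager_covering \<C> \<and> cov_B = |\<C>| \<and> (\<forall>\<D>. meager_covering \<D> \<longrightarrow> cov_B \<le>o |\<D>| )"
proof -
  let ?R = "card_of ` {\<C>. meager_covering \<C>}"
  have "?R \<noteq> {}"
    using meager_covering_singletons by blast
  moreover have "\<forall>r\<in>?R. Card_order r"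
    by (auto simp: card_of_Card_order)
  ultimately have "\<exists>r\<in>?R. \<forall>r'\<in>?R. r \<le>o r'"
    by (rule exists_minim_Card_order)
  then have "\<exists>r \<C>. meager_covering \<C> \<and> r = |\<C>| \<and>
      (\<forall>\<D>. meager_covering \<D> \<longrightarrow> r \<le>o |\<D>| )"
    by blast
  then show ?thesis
    unfolding cov_B_def by (rule someI_ex)
qed

definition continuum :: "(nat \<Rightarrow> bool) rel" where
  "continuum = ctwo ^c natLeq"

(* An m-tuple is a list of length m. Elements of the m-th power of 2 = {0,1} are
   lists of Booleans of length m, with True for 1 and False for 0. *)
definition tuple_type :: "real list \<Rightarrow> real list \<Rightarrow> bool list" where
  "tuple_type e e' = map2 (\<lambda>x x'. x' < x) e e'"

definition realizes :: "real list \<Rightarrow> real list \<Rightarrow> bool list \<Rightarrow> bool" where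
  "realizes e e' t \<longleftrightarrow> tuple_type e e' = t \<or> tuple_type e e' = map Not t"

(* Intended for infinite cardinals \<kappa> and m > 0. *)
definition entangled :: "'k rel \<Rightarrow> nat \<Rightarrow> real set \<Rightarrow> bool" where
  "entangled \<kappa> m E \<longleftrightarrow>
     \<kappa> \<le>o |E| \<and>
     (\<forall>F t. |F| =o \<kappa> \<and>
            (\<forall>e\<in>F. length e = m \<and> distinct e \<and> set e \<subseteq> E) \<and>
            pairwise (\<lambda>e e'. disjnt (set e) (set e')) F \<and>
            length t = m \<longrightarrow>
            (\<exists>e\<in>F. \<exists>e'\<in>F. e \<noteq> e' \<and> realizes e e' t))"

end

(*
  The set E consists of the entries of c-many points of the hyperplane x_0 + ... + x_n = 0 in
  R^(n+1), chosen by transfinite recursion so that each is generic over the earlier ones. Two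
  distinct points of the hyperplane are never comparable coordinatewise, so the (n+1)-tuples given
  by the chosen points omit the type (1,...,1). Any n coordinates of a point of the hyperplane are
  independent, so an n-tuple of elements of E that were all chosen late enough avoids a given
  closed nowhere dense set. If F is a disjoint family of c-many n-tuples, apply this to the
  boundary of the closure of F: some tuple e of F lies in the interior of that closure, and then
  F meets every open orthant at e.
*)
theory Submission
  imports Defs
begin

section \<open>Closed nowhere dense sets and their sections\<close>

text \<open>Subsets of \<open>\<real>\<^sup>m\<close>, with varying \<open>m\<close>, are represented by cylinders over the first \<open>m\<close>
  coordinates in the single space \<^typ>\<open>nat \<Rightarrow> real\<close> with its product topology.\<close>

definition thin :: "(nat \<Rightarrow> real) set \<Rightarrow> bool" where
  "thin N \<longleftrightarrow> closed N \<and> interior N = {}"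

text \<open>A section remains a subset of the whole space, with the coordinates in \<open>A\<close>
  left unrestricted, so that thinness is one notion for all sections and sections can be
  iterated.\<close>

definition sect :: "(nat \<Rightarrow> real) set \<Rightarrow> nat set \<Rightarrow> (nat \<Rightarrow> real) \<Rightarrow> (nat \<Rightarrow> real) set" where
  "sect N A v = {x. override_on x v A \<in> N}"

lemma sect_empty [simp]: "sect N {} v = N"
  by (simp add: sect_def)

lemma sect_cong: "(\<And>i. i \<in> A \<Longrightarrow> v i = w i) \<Longrightarrow> sect N A v = sect N A w"
proof -
  assume "\<And>i. i \<in> A \<Longrightarrow> v i = w i"
  then have "override_on x v A = override_on x w A" for x by (auto simp: override_on_def)
  then show ?thesis by (simp add: sect_def)
qed

lemma sect_sect: "sect (sect N A v) B w = sect N (A \<union> B) (override_on w v A)"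
proof -
  have "override_on (override_on x w B) v A = override_on x (override_on w v A) (A \<union> B)" for x
    by (auto simp: override_on_def)
  then show ?thesis by (simp add: sect_def)
qed

lemma thin_ex_notin: "thin N \<Longrightarrow> open U \<Longrightarrow> U \<noteq> {} \<Longrightarrow> \<exists>x\<in>U. x \<notin> N"
  unfolding thin_def using interior_maximal[of U N] by blast

lemma thinI: "closed N \<Longrightarrow> (\<And>U. open U \<Longrightarrow> U \<subseteq> N \<Longrightarrow> U = {}) \<Longrightarrow> thin N"
  unfolding thin_def using interior_subset[of N] open_interior[of N] by blast

lemma thin_frontier: "closed C \<Longrightarrow> thin (C - interior C)"
proof (rule thinI)
  fix U assume "open U" and U: "U \<subseteq> C - interior C"
  then have "U \<subseteq> interior C" by (intro interior_maximal) auto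
  with U show "U = {}" by blast
qed (auto intro: closed_Diff)

lemma continuous_override: "continuous_on UNIV (\<lambda>x::nat \<Rightarrow> real. override_on x v A)"
proof (rule continuous_on_coordinatewise_then_product)
  fix i
  show "continuous_on UNIV (\<lambda>x. override_on x v A i)"
    by (cases "i \<in> A") auto
qed

lemma closed_sect: "closed N \<Longrightarrow> closed (sect N A v)"
  using closed_vimage[OF _ continuous_override, of N v A] by (simp add: vimage_def sect_def)

section \<open>Exceptional sections of a closed nowhere dense set\<close>

text \<open>The easy direction of the Kuratowski--Ulam theorem, one coordinate at a time.\<close>

lemma meager_not_thin_sect:
  assumes "thin N"
  shows "meager {r. \<not> thin (sect N {k} (\<lambda>_. r))}"
proof -
  have cl: "closed N" using assms by (simp add: thin_def)
  obtain \<B> :: "(nat \<Rightarrow> real) set set" where cB: "countable \<B>" and tB: "topological_basis \<B>"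
    using ex_countable_basis by blast
  \<comment> \<open>\<open>bad U\<close> collects the values \<open>r\<close> whose section contains
    \<open>U\<close>.\<close>
  define bad where "bad U = {r. \<forall>x\<in>U. x(k := r) \<in> N}" for U
  have cont1: "continuous_on UNIV (\<lambda>r. x(k := r))" for x :: "nat \<Rightarrow> real"
  proof (rule continuous_on_coordinatewise_then_product)
    show "continuous_on UNIV (\<lambda>r. (x(k := r)) i)" for i
      by (cases "i = k") auto
  qed
  have cont2: "continuous_on UNIV (\<lambda>x :: nat \<Rightarrow> real. x(k := r))" for r
    using continuous_override[of "\<lambda>_. r" "{k}"] by (simp add: override_on_def fun_upd_def)
  have clbad: "closed (bad U)" for U
  proof -
    have "bad U = (\<Inter>x\<in>U. (\<lambda>r. x(k := r)) -` N)" by (auto simp: bad_def)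
    then show ?thesis using closed_vimage[OF cl cont1] by auto
  qed
  have int: "interior (bad U) = {}" if U: "open U" "U \<noteq> {}" for U
  proof (rule ccontr)
    assume ne: "interior (bad U) \<noteq> {}"
    \<comment> \<open>\<open>W\<close> is a box: its \<open>k\<close>-th side is the interior of
      \<open>bad U\<close>, the other coordinates range over the projection of \<open>U\<close>. It
      would be a nonempty open subset of \<open>N\<close>.\<close>
    define W where "W = (\<lambda>y. y k) -` interior (bad U) \<inter> (\<Union>r. (\<lambda>y. y(k := r)) -` U)"
    have "open W" unfolding W_def
      by (intro open_Int open_UN ballI open_vimage[OF U(1) cont2]
            open_vimage[OF open_interior continuous_on_product_coordinates])
    moreover have "W \<subseteq> N"
    proof
      fix y assume "y \<in> W"
      then obtain r where "y k \<in> bad U" "y(k := r) \<in> U"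
        using interior_subset by (fastforce simp: W_def)
      then have "(y(k := r))(k := y k) \<in> N" unfolding bad_def by blast
      then show "y \<in> N" by simp
    qed
    moreover obtain s u where "s \<in> interior (bad U)" "u \<in> U" using ne U by blast
    then have "u(k := s) \<in> W" by (auto simp: W_def intro!: exI[of _ "u k"])
    ultimately show False using thin_ex_notin[OF assms] by blast
  qed
  have bad_iff: "r \<in> bad U \<longleftrightarrow> U \<subseteq> sect N {k} (\<lambda>_. r)" for r U
    by (auto simp: bad_def sect_def override_on_insert)
  \<comment> \<open>A closed section that is not thin contains a nonempty basic open set, so
    countably many sets \<open>bad U\<close> suffice.\<close>
  have eq: "{r. \<not> thin (sect N {k} (\<lambda>_. r))} = \<Union> (bad ` (\<B> - {{}}))"
  proof (intro set_eqI iffI)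
    fix r assume "r \<in> {r. \<not> thin (sect N {k} (\<lambda>_. r))}"
    then obtain x where "x \<in> interior (sect N {k} (\<lambda>_. r))"
      using closed_sect[OF cl] unfolding thin_def by blast
    then obtain U where "U \<in> \<B>" "x \<in> U" "U \<subseteq> interior (sect N {k} (\<lambda>_. r))"
      using topological_basisE[OF tB open_interior] by blast
    then have "r \<in> bad U" "U \<in> \<B> - {{}}"
      using interior_subset[of "sect N {k} (\<lambda>_. r)"] unfolding bad_iff by auto
    then show "r \<in> \<Union> (bad ` (\<B> - {{}}))" by blast
  next
    fix r assume "r \<in> \<Union> (bad ` (\<B> - {{}}))"
    then obtain U where U: "U \<in> \<B>" "U \<noteq> {}" "U \<subseteq> sect N {k} (\<lambda>_. r)"
      unfolding UN_iff bad_iff by blast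
    with topological_basis_open[OF tB] have "\<not> thin (sect N {k} (\<lambda>_. r))"
      by (meson subsetD thin_ex_notin)
    then show "r \<in> {r. \<not> thin (sect N {k} (\<lambda>_. r))}" by simp
  qed
  have "nowhere_dense (bad U)" if "U \<in> \<B> - {{}}" for U
    using that int[of U] topological_basis_open[OF tB, of U] clbad[of U]
    by (simp add: nowhere_dense_def)
  with cB show ?thesis
    unfolding meager_def eq by (intro exI[of _ "bad ` (\<B> - {{}})"]) auto
qed

section \<open>Sets of size less than the continuum\<close>

lemma continuum_eq: "continuum = |UNIV :: (nat \<Rightarrow> bool) set|"
proof -
  have "Func UNIV UNIV = (UNIV :: (nat \<Rightarrow> bool) set)" by (auto simp: Func_def)
  then show ?thesis
    by (simp add: continuum_def cexp_def ctwo_def Field_natLeq Field_card_of)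
qed

abbreviation small :: "'a set \<Rightarrow> bool" where
  "small A \<equiv> |A| <o continuum"

lemma infinite_UNIV_nat_bool: "infinite (UNIV :: (nat \<Rightarrow> bool) set)"
  using finite_fun_UNIVD1[where 'a=nat and 'b=bool] by auto

lemma small_finite: "finite A \<Longrightarrow> small A"
  unfolding continuum_eq
  by (rule finite_ordLess_infinite)
    (auto simp: infinite_UNIV_nat_bool Field_card_of card_of_Well_order[unfolded Field_card_of]
      intro: card_of_Well_order)

lemma small_Times: "small A \<Longrightarrow> small B \<Longrightarrow> small (A \<times> B)"
proof -
  assume AB: "small A" "small B"
  consider "finite A \<and> finite B" | "infinite A" "|B| \<le>o |A|" | "infinite B" "|A| \<le>o |B|"
    using ordLeq_total[OF card_of_Well_order card_of_Well_order, of A B]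
      card_of_ordLeq_finite[of A B] card_of_ordLeq_finite[of B A] by blast
  then show "small (A \<times> B)"
  proof cases
    case 1
    then show ?thesis by (simp add: small_finite)
  next
    case 2
    then have "|A \<times> B| \<le>o |A|"
      by (intro card_of_Times_ordLeq_infinite_Field)
        (auto simp: Field_card_of
          intro: card_of_Card_order[unfolded Field_card_of] card_of_refl[THEN ordIso_imp_ordLeq])
    then show ?thesis using AB ordLeq_ordLess_trans by blast
  next
    case 3
    then have "|A \<times> B| \<le>o |B|"
      by (intro card_of_Times_ordLeq_infinite_Field)
        (auto simp: Field_card_of
          intro: card_of_Card_order[unfolded Field_card_of] card_of_refl[THEN ordIso_imp_ordLeq])
    then show ?thesis using AB ordLeq_ordLess_trans by blast
  qed
qed

lemma small_Un: "small A \<Longrightarrow> small B \<Longrightarrow> small (A \<union> B)"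
  unfolding continuum_eq by (rule card_of_Un_ordLess_infinite[OF infinite_UNIV_nat_bool])

lemma small_insert: "small A \<Longrightarrow> small (insert x A)"
  using small_Un[OF small_finite[of "{x}"], of A] by simp

lemma small_image: "small A \<Longrightarrow> small (f ` A)"
  using card_of_image ordLeq_ordLess_trans by blast

lemma small_subset: "small A \<Longrightarrow> B \<subseteq> A \<Longrightarrow> small B"
  using card_of_mono1 ordLeq_ordLess_trans by blast

lemma small_lists: "small A \<Longrightarrow> small {xs. length xs = m \<and> set xs \<subseteq> A}"
proof (induction m)
  case 0
  then show ?case by (intro small_finite) (auto intro: finite_subset[of _ "{[]}"])
next
  case (Suc m)
  have "{xs. length xs = Suc m \<and> set xs \<subseteq> A} \<subseteq>
      (\<lambda>(x, xs). x # xs) ` (A \<times> {xs. length xs = m \<and> set xs \<subseteq> A})"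
    by (force simp: length_Suc_conv)
  then show ?case
    by (rule small_subset[OF small_image[OF small_Times[OF Suc.prems Suc.IH[OF Suc.prems]]]])
qed

section \<open>Generic points from the hypothesis on \<open>cov_B\<close>\<close>

text \<open>Otherwise the sets \<open>M i\<close> would form a meager covering with fewer than
  \<open>cov_B\<close> members. Every use of the hypothesis on \<open>cov_B\<close> goes through
  this lemma.\<close>

lemma ex_generic_real:
  fixes M :: "'i \<Rightarrow> real set"
  assumes cov: "cov_B =o continuum" and "small I" and "\<And>i. i \<in> I \<Longrightarrow> meager (M i)"
  shows "\<exists>r. \<forall>i\<in>I. r \<notin> M i"
proof (rule ccontr)
  assume "\<not> ?thesis"
  then have "meager_covering (M ` I)"
    using assms(3) unfolding meager_covering_def by blast
  then have "cov_B \<le>o |M ` I|" using cov_B_least by auto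
  moreover have "|M ` I| <o cov_B"
    using small_image[OF assms(2)] ordLess_ordIso_trans ordIso_symmetric[OF cov] by blast
  ultimately show False using not_ordLess_ordLeq by blast
qed

text \<open>Coordinates are chosen one at a time. While all sections are thin, each \<open>N\<close>
  excludes only a meager set of values for the next coordinate, and fewer than continuum many meager
  sets leave some value over.\<close>

lemma ex_generic_point:
  assumes cov: "cov_B =o continuum" and small: "small \<N>" and thin: "\<And>N. N \<in> \<N> \<Longrightarrow> thin N"
  shows "\<exists>y. \<forall>N\<in>\<N>. thin (sect N {..<K} y)"
proof (induction K)
  case 0
  then show ?case using thin by simp
next
  case (Suc K)
  then obtain y where y: "\<And>N. N \<in> \<N> \<Longrightarrow> thin (sect N {..<K} y)" by blast
  obtain r where r: "\<And>N. N \<in> \<N> \<Longrightarrow> thin (sect (sect N {..<K} y) {K} (\<lambda>_. r))"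
    using ex_generic_real[OF cov small meager_not_thin_sect[OF y], of "\<lambda>N. N" "\<lambda>_. K"] by auto
  have "thin (sect N {..<Suc K} (y(K := r)))" if "N \<in> \<N>" for N
  proof -
    have "sect N {..<Suc K} (y(K := r)) = sect N ({..<K} \<union> {K}) (override_on (\<lambda>_. r) y {..<K})"
      by (subst lessThan_Suc, subst insert_is_Un, subst Un_commute, rule sect_cong)
        (auto simp: override_on_def)
    then show ?thesis using r[OF that] by (simp add: sect_sect)
  qed
  then show ?case by blast
qed

section \<open>Generic points of the hyperplane\<close>

text \<open>\<open>sec\<close> gives a continuous right inverse \<open>s\<close> of \<open>f\<close>
  through every point \<open>p\<close>. A nonempty open subset of the preimage would pull back along
  \<open>s\<close> to a nonempty open subset of \<open>N\<close>.\<close>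

lemma thin_vimage:
  assumes "thin N" and cont: "continuous_on UNIV f"
    and sec: "\<And>p. \<exists>s. continuous_on UNIV s \<and> s (f p) = p \<and> (\<forall>z. f (s z) = z)"
  shows "thin (f -` N)"
proof (rule thinI)
  show "closed (f -` N)"
    using closed_vimage[OF _ cont] assms(1) by (simp add: thin_def)
  fix U assume U: "open U" "U \<subseteq> f -` N"
  show "U = {}"
  proof (rule ccontr)
    assume "U \<noteq> {}"
    then obtain p where p: "p \<in> U" by blast
    obtain s where s: "continuous_on UNIV s" "s (f p) = p" "\<And>z. f (s z) = z"
      using sec by blast
    have "s -` U \<noteq> {}" using p s(2) by (metis empty_iff vimageI)
    then obtain z where "s z \<in> U" "z \<notin> N"
      using thin_ex_notin[OF assms(1) open_vimage[OF U(1) s(1)]] by auto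
    then show False using U(2) s(3)[of z] by auto
  qed
qed

text \<open>The first \<open>n\<close> entries of \<open>w\<close> parametrise the hyperplane \<open>x\<^sub>0 + \<dots> + x\<^sub>n = 0\<close>.\<close>

definition closing :: "nat \<Rightarrow> (nat \<Rightarrow> real) \<Rightarrow> nat \<Rightarrow> real" where
  "closing n w k = (if k < n then w k else - (\<Sum>i<n. w i))"

lemma sum_closing: "(\<Sum>k\<le>n. closing n w k) = 0"
  by (simp add: closing_def flip: lessThan_Suc_atMost)

lemma closing_unique:
  assumes "(\<Sum>k\<le>n. v k) = 0" "\<And>k. k < n \<Longrightarrow> w k = v k" "k \<le> n"
  shows "closing n w k = v k"
proof -
  have "(\<Sum>k<n. w k) = (\<Sum>k<n. v k)" using assms(2) by (intro sum.cong) auto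
  moreover have "(\<Sum>k<n. v k) + v n = 0" using assms(1) by (simp flip: lessThan_Suc_atMost)
  ultimately show ?thesis using assms(2,3) by (cases "k = n") (auto simp: closing_def)
qed

text \<open>The space of all \<open>w\<close> combines a candidate block (entries below \<open>n\<close>) with the coordinates that are
  still free (entries from \<open>n\<close> on); \<open>insert_block\<close> puts entry \<open>\<sigma> i\<close> of the block at each
  coordinate \<open>i \<in> B\<close>.\<close>

definition insert_block :: "nat \<Rightarrow> nat set \<Rightarrow> (nat \<Rightarrow> nat) \<Rightarrow> (nat \<Rightarrow> real) \<Rightarrow> nat \<Rightarrow> real" where
  "insert_block n B \<sigma> w i = (if i \<in> B then closing n w (\<sigma> i) else w (n + i))"

lemma thin_vimage_insert_block:
  assumes "thin N" and inj: "inj_on \<sigma> B" and sub: "\<sigma> ` B \<subset> {..n}"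
  shows "thin (insert_block n B \<sigma> -` N)"
proof (rule thin_vimage[OF assms(1)])
  have "continuous_on UNIV (\<lambda>w. closing n w k)" for k
    by (cases "k < n") (auto simp: closing_def intro!: continuous_intros)
  then have "continuous_on UNIV (\<lambda>w. insert_block n B \<sigma> w i)" for i
    by (cases "i \<in> B") (auto simp: insert_block_def)
  then show "continuous_on UNIV (insert_block n B \<sigma>)"
    by (rule continuous_on_coordinatewise_then_product)
next
  fix p :: "nat \<Rightarrow> real"
  \<comment> \<open>Since \<open>\<sigma>\<close> misses some index \<open>j\<close>, the \<open>j\<close>-th entry of the block can absorb the sum condition.\<close>
  obtain j where j: "j \<le> n" "j \<notin> \<sigma> ` B" using sub by auto
  \<comment> \<open>\<open>u\<close> takes the entries in the image of \<open>\<sigma>\<close> from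
    \<open>z\<close> and the others from \<open>p\<close>; \<open>v\<close> restores sum zero at
    entry \<open>j\<close>; \<open>s\<close> stores the first \<open>n\<close> entries of
    \<open>v\<close>. The coordinates \<open>n + i\<close> with \<open>i \<in> B\<close> are not
    read by \<open>insert_block\<close>; copying them from \<open>p\<close> makes \<open>s\<close>
    return exactly \<open>p\<close>.\<close>
  define u where "u z k = (if k \<in> \<sigma> ` B then z (inv_into B \<sigma> k) else closing n p k)"
    for z :: "nat \<Rightarrow> real" and k
  define v where "v z k = (if k = j then - (\<Sum>k\<in>{..n} - {j}. u z k) else u z k)" for z k
  define s where "s z k = (if k < n then v z k else if k - n \<in> B then p k else z (k - n))" for z k
  have cu: "continuous_on UNIV (\<lambda>z. u z k)" for k
    by (cases "k \<in> \<sigma> ` B") (auto simp: u_def)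
  have "continuous_on UNIV (\<lambda>z. v z k)" for k
    by (cases "k = j") (auto simp: v_def intro!: continuous_intros cu)
  then have "continuous_on UNIV (\<lambda>z. s z k)" for k
    by (cases "k < n"; cases "k - n \<in> B") (auto simp: s_def)
  then have cs: "continuous_on UNIV s"
    by (rule continuous_on_coordinatewise_then_product)
  have split: "(\<Sum>k\<le>n. f k) = f j + (\<Sum>k\<in>{..n} - {j}. f k)" for f :: "nat \<Rightarrow> real"
    using j(1) by (simp add: sum.remove)
  have "(\<Sum>k\<in>{..n} - {j}. v z k) = (\<Sum>k\<in>{..n} - {j}. u z k)" for z
    by (intro sum.cong) (auto simp: v_def)
  then have sumv: "(\<Sum>k\<le>n. v z k) = 0" for z
    unfolding split by (simp add: v_def)
  have "insert_block n B \<sigma> (s z) i = z i" for z i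
  proof (cases "i \<in> B")
    case True
    then have "\<sigma> i \<le> n" "\<sigma> i \<noteq> j" using sub j(2) by auto
    moreover have "closing n (s z) (\<sigma> i) = v z (\<sigma> i)"
      by (rule closing_unique[OF sumv _ \<open>\<sigma> i \<le> n\<close>]) (simp add: s_def)
    ultimately show ?thesis using True inj by (simp add: insert_block_def v_def u_def)
  qed (simp add: insert_block_def s_def)
  moreover have "s (insert_block n B \<sigma> p) k = p k" for k
  proof -
    let ?z = "insert_block n B \<sigma> p"
    have u: "u ?z k = closing n p k" for k
      by (auto simp: u_def insert_block_def inv_into_into f_inv_into_f image_iff inj)
    have "v ?z k = closing n p k" for k
      using sum_closing[of n p] unfolding split by (auto simp: v_def u)
    then show ?thesis by (simp add: s_def closing_def insert_block_def)
  qed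
  ultimately show "\<exists>s. continuous_on UNIV s \<and> s (insert_block n B \<sigma> p) = p \<and>
      (\<forall>z. insert_block n B \<sigma> (s z) = z)"
    using cs by blast
qed

text \<open>\<open>ex_generic_point\<close> is applied to the preimages of all \<open>N\<close>
  under the maps \<open>insert_block\<close>. Only the values of \<open>\<sigma>\<close> on
  \<open>B\<close> matter, which leaves finitely many patterns, so the family of preimages is still
  small.\<close>

lemma ex_generic_block:
  assumes cov: "cov_B =o continuum" and small: "small \<N>" and thin: "\<And>N. N \<in> \<N> \<Longrightarrow> thin N"
  shows "\<exists>y. (\<Sum>k\<le>n. y k) = 0 \<and> (\<forall>N\<in>\<N>. \<forall>B \<sigma>. B \<subseteq> {..<n} \<longrightarrow> inj_on \<sigma> B \<longrightarrow> \<sigma> ` B \<subseteq> {..n} \<longrightarrow>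
            thin (sect N B (y \<circ> \<sigma>)))"
proof -
  define S where "S = {(B, l). B \<subseteq> {..<n} \<and> length l = n \<and> set l \<subseteq> {..n} \<and> inj_on ((!) l) B}"
  have "S \<subseteq> Pow {..<n} \<times> {l. set l \<subseteq> {..n} \<and> length l = n}" by (auto simp: S_def)
  then have "finite S" by (rule finite_subset) (simp add: finite_lists_length_eq)
  define \<N>' where "\<N>' = (\<lambda>(N, B, l). insert_block n B ((!) l) -` N) ` (\<N> \<times> S)"
  have "small \<N>'"
    unfolding \<N>'_def by (intro small_image small_Times small small_finite \<open>finite S\<close>)
  moreover have "thin M" if M: "M \<in> \<N>'" for M
  proof -
    obtain N B l where N: "N \<in> \<N>" "(B, l) \<in> S" and M_eq: "M = insert_block n B ((!) l) -` N"
      using M by (auto simp: \<N>'_def)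
    then have B: "B \<subseteq> {..<n}" "inj_on ((!) l) B" "(!) l ` B \<subseteq> {..n}"
      unfolding S_def by (auto simp: subset_iff)
    \<comment> \<open>\<open>B\<close> has at most \<open>n\<close> elements, while a block has
      \<open>n + 1\<close> entries.\<close>
    moreover have "card ((!) l ` B) < card {..n}"
      using card_image[OF B(2)] card_mono[OF _ B(1)] by simp
    ultimately have "(!) l ` B \<subset> {..n}" by (metis less_irrefl psubsetI)
    then show ?thesis unfolding M_eq by (rule thin_vimage_insert_block[OF thin[OF N(1)] B(2)])
  qed
  ultimately obtain w where w: "\<And>M. M \<in> \<N>' \<Longrightarrow> thin (sect M {..<n} w)"
    using ex_generic_point[OF cov, of \<N>' n] by blast
  have "thin (sect N B (closing n w \<circ> \<sigma>))"
    if N: "N \<in> \<N>" and B: "B \<subseteq> {..<n}" "inj_on \<sigma> B" "\<sigma> ` B \<subseteq> {..n}" for N B \<sigma>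
  proof (rule thinI)
    show "closed (sect N B (closing n w \<circ> \<sigma>))"
      using closed_sect thin[OF N] by (simp add: thin_def)
    \<comment> \<open>The default 0 outside \<open>B\<close> is a legal index and is never
      read.\<close>
    define l where "l = map (\<lambda>i. if i \<in> B then \<sigma> i else 0) [0..<n]"
    have l: "l ! i = \<sigma> i" if "i \<in> B" for i using that B(1) by (auto simp: l_def)
    have "(B, l) \<in> S" using B l by (auto simp: S_def l_def inj_on_def)
    then have "insert_block n B ((!) l) -` N \<in> \<N>'"
      using N unfolding \<N>'_def by (intro image_eqI[of _ _ "(N, B, l)"]) auto
    then have th: "thin (sect (insert_block n B ((!) l) -` N) {..<n} w)" by (rule w)
    \<comment> \<open>With the first \<open>n\<close> coordinates fixed to \<open>w\<close>, the
      preimage of \<open>N\<close> is the section of \<open>N\<close> moved up by \<open>n\<close>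
      coordinates. The shift is onto, so \<open>U\<close> is empty once its preimage under the shift
      is.\<close>
    have eq: "insert_block n B ((!) l) (override_on x w {..<n}) =
        override_on (\<lambda>i. x (n + i)) (closing n w \<circ> \<sigma>) B" for x
      by (auto simp: fun_eq_iff insert_block_def override_on_def l closing_def)
    fix U assume U: "open U" "U \<subseteq> sect N B (closing n w \<circ> \<sigma>)"
    have "continuous_on UNIV (\<lambda>x :: nat \<Rightarrow> real. \<lambda>i. x (n + i))"
      by (rule continuous_on_coordinatewise_then_product) simp
    then have "open ((\<lambda>x. \<lambda>i. x (n + i)) -` U)" by (rule open_vimage[OF U(1)])
    moreover have "(\<lambda>x. \<lambda>i. x (n + i)) -` U \<subseteq> sect (insert_block n B ((!) l) -` N) {..<n} w"
      using U(2) by (auto simp: sect_def eq)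
    ultimately have "(\<lambda>x. \<lambda>i. x (n + i)) -` U = {}"
      using thin_ex_notin[OF th, of "(\<lambda>x. \<lambda>i. x (n + i)) -` U"] by auto
    moreover have "(\<lambda>k. u (k - n)) \<in> (\<lambda>x. \<lambda>i. x (n + i)) -` U" if "u \<in> U" for u
      using that by simp
    ultimately show "U = {}" by (metis equals0I empty_iff)
  qed
  then show ?thesis
    by (intro exI[of _ "closing n w"]) (simp add: sum_closing)
qed

section \<open>Transfinite construction of the blocks\<close>

text \<open>A closed set is coded by a set of basic open sets with union its complement. Codes have
  the type that also indexes the blocks, so each thin set can be respected at all stages from its
  code on.\<close>

lemma ex_closed_code:
  "\<exists>C :: (nat \<Rightarrow> bool) \<Rightarrow> (nat \<Rightarrow> real) set. \<forall>N. closed N \<longrightarrow> (\<exists>b. N = C b)"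
proof -
  obtain \<B> :: "(nat \<Rightarrow> real) set set" where cB: "countable \<B>" and tB: "topological_basis \<B>"
    using ex_countable_basis by blast
  define C where "C b = - \<Union>{U \<in> \<B>. b (to_nat_on \<B> U)}" for b
  have "\<exists>b. N = C b" if N: "closed N" for N
  proof -
    obtain \<U> where U: "\<U> \<subseteq> \<B>" "\<Union>\<U> = - N"
      using tB N unfolding topological_basis_def closed_def by meson
    define b where "b k \<longleftrightarrow> k \<in> to_nat_on \<B> ` \<U>" for k
    have "{U \<in> \<B>. b (to_nat_on \<B> U)} = \<U>"
      using U(1) inj_on_to_nat_on[OF cB] by (auto simp: b_def inj_on_def)
    then have "N = C b" using U(2) by (simp add: C_def)
    then show ?thesis by blast
  qed
  then show ?thesis by blast
qed

lemma finite_total_max: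
  assumes "total r" "trans r" "refl r" "finite Q" "Q \<noteq> {}"
  shows "\<exists>m\<in>Q. \<forall>q\<in>Q. (q, m) \<in> r"
  using assms(4,5)
proof (induction rule: finite_ne_induct)
  case (singleton x)
  then show ?case using assms(3) by (auto simp: refl_on_def)
next
  case (insert x Q)
  then obtain m where m: "m \<in> Q" "\<forall>q\<in>Q. (q, m) \<in> r" by blast
  have "(x, m) \<in> r \<or> (m, x) \<in> r"
    using assms(1,3) unfolding total_on_def refl_on_def by (cases "x = m") auto
  then show ?case
  proof
    assume "(m, x) \<in> r"
    then have "\<forall>q\<in>insert x Q. (q, x) \<in> r"
      using m(2) assms(2,3) unfolding refl_on_def trans_def by blast
    then show ?thesis by blast
  qed (use m in blast)
qed

text \<open>The block \<open>X \<beta>\<close> is generic over the sections, by earlier entries, of the thin sets with code at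
  most \<open>\<beta>\<close>. So \<open>S\<close> is the set of blocks preceding the code of \<open>N\<close>, and the coordinates in \<open>A\<close>
  are fixed block by block, in increasing order.\<close>

lemma ex_generic_family:
  assumes cov: "cov_B =o continuum"
  shows "\<exists>X :: (nat \<Rightarrow> bool) \<Rightarrow> nat \<Rightarrow> real. (\<forall>\<beta>. (\<Sum>k\<le>n. X \<beta> k) = 0) \<and>
    (\<forall>N. thin N \<longrightarrow> (\<exists>S. small S \<and> (\<forall>A p. A \<subseteq> {..<n} \<longrightarrow> inj_on p A \<longrightarrow>
      p ` A \<subseteq> (- S) \<times> {..n} \<longrightarrow> thin (sect N A (case_prod X \<circ> p)))))"
proof -
  \<comment> \<open>Since \<open>r\<close> is a cardinal order, its proper initial segments are
    small.\<close>
  define r where "r = |UNIV :: (nat \<Rightarrow> bool) set|"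
  define R where "R = r - Id"
  have "well_order_on UNIV r" unfolding r_def by (rule card_of_well_order_on)
  then have wf: "wf R" and tot: "total r" and trans: "trans r" and refl: "refl r"
    unfolding well_order_on_def linear_order_on_def partial_order_on_def preorder_on_def R_def
    by auto
  have small_below: "small {\<delta>. (\<delta>, \<beta>) \<in> R}" for \<beta>
  proof -
    have "{\<delta>. (\<delta>, \<beta>) \<in> R} = underS r \<beta>" by (auto simp: R_def underS_def)
    then show ?thesis
      using card_of_underS[OF card_of_Card_order, of \<beta> "UNIV :: (nat \<Rightarrow> bool) set"]
      by (simp add: r_def continuum_eq Field_card_of)
  qed
  obtain C :: "(nat \<Rightarrow> bool) \<Rightarrow> (nat \<Rightarrow> real) set" where C: "\<forall>N. closed N \<longrightarrow> (\<exists>b. N = C b)"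
    using ex_closed_code by (rule exE)
  \<comment> \<open>\<open>P f \<beta> y\<close> says that \<open>y\<close> is an admissible block
    at stage \<open>\<beta>\<close>. Here \<open>v\<close> fixes the coordinates in \<open>A\<close>
    to entries of earlier blocks \<open>f \<delta>\<close>; if that section is thin, it has to stay
    thin when entries of \<open>y\<close> are put at the coordinates in \<open>B\<close>.\<close>
  define P where "P f \<beta> y \<longleftrightarrow> (\<Sum>k\<le>n. y k) = 0 \<and>
    (\<forall>\<gamma> A v. (\<gamma>, \<beta>) \<in> r \<longrightarrow> A \<subseteq> {..<n} \<longrightarrow> (\<forall>i\<in>A. \<exists>\<delta>. (\<delta>, \<beta>) \<in> R \<and> (\<exists>j\<le>n. v i = f \<delta> j)) \<longrightarrow>
      thin (sect (C \<gamma>) A v) \<longrightarrow>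
      (\<forall>B \<sigma>. B \<subseteq> {..<n} \<longrightarrow> inj_on \<sigma> B \<longrightarrow> \<sigma> ` B \<subseteq> {..n} \<longrightarrow> thin (sect (sect (C \<gamma>) A v) B (y \<circ> \<sigma>))))"
    for f :: "(nat \<Rightarrow> bool) \<Rightarrow> nat \<Rightarrow> real" and \<beta> y
  have exP: "\<exists>y. P f \<beta> y" for f \<beta>
  proof -
    \<comment> \<open>The sections to be respected are coded by lists over the earlier entries,
      hence form a small family. The value 0 fills the places outside \<open>A\<close>.\<close>
    define W where "W = insert 0 ((\<lambda>(\<delta>, j). f \<delta> j) ` ({\<delta>. (\<delta>, \<beta>) \<in> R} \<times> {..n}))"
    define I where "I = insert \<beta> {\<delta>. (\<delta>, \<beta>) \<in> R} \<times> Pow {..<n} \<times> {l. length l = n \<and> set l \<subseteq> W}"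
    define \<N> where "\<N> = {M \<in> (\<lambda>(\<gamma>, A, l). sect (C \<gamma>) A ((!) l)) ` I. thin M}"
    have \<N>_thin: "thin M" if "M \<in> \<N>" for M using that by (simp add: \<N>_def)
    have "small W" unfolding W_def
      by (intro small_insert small_image small_Times small_below small_finite) auto
    moreover have "small (insert \<beta> {\<delta>. (\<delta>, \<beta>) \<in> R})"
      by (intro small_insert small_below)
    ultimately have "small I" unfolding I_def
      by (intro small_Times small_lists) (auto intro: small_finite)
    moreover have "\<N> \<subseteq> (\<lambda>(\<gamma>, A, l). sect (C \<gamma>) A ((!) l)) ` I" unfolding \<N>_def by (rule Collect_restrict)
    ultimately have "small \<N>" by (rule small_subset[OF small_image])
    then obtain y where y0: "(\<Sum>k\<le>n. y k) = 0" and y: "\<And>M B \<sigma>. M \<in> \<N> \<Longrightarrow> B \<subseteq> {..<n} \<Longrightarrow>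
        inj_on \<sigma> B \<Longrightarrow> \<sigma> ` B \<subseteq> {..n} \<Longrightarrow> thin (sect M B (y \<circ> \<sigma>))"
      using ex_generic_block[OF cov, of \<N> n] \<N>_thin by auto
    have "sect (C \<gamma>) A v \<in> \<N>" if "(\<gamma>, \<beta>) \<in> r" "A \<subseteq> {..<n}"
        "\<forall>i\<in>A. \<exists>\<delta>. (\<delta>, \<beta>) \<in> R \<and> (\<exists>j\<le>n. v i = f \<delta> j)" "thin (sect (C \<gamma>) A v)" for \<gamma> A v
    proof -
      define l where "l = map (\<lambda>i. if i \<in> A then v i else 0) [0..<n]"
      have "set l \<subseteq> W"
      proof
        fix x assume "x \<in> set l"
        then consider "x = 0" | i where "i \<in> A" "x = v i" by (auto simp: l_def split: if_splits)
        then show "x \<in> W"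
        proof cases
          case 2
          with that(3) obtain \<delta> j where "(\<delta>, \<beta>) \<in> R" "j \<le> n" "x = f \<delta> j" by auto
          then show ?thesis unfolding W_def
            by (intro insertI2 image_eqI[of _ _ "(\<delta>, j)"]) auto
        qed (simp add: W_def)
      qed
      then have "(\<gamma>, A, l) \<in> I" using that(1,2) by (auto simp: I_def R_def l_def)
      moreover have "sect (C \<gamma>) A v = sect (C \<gamma>) A ((!) l)"
        using that(2) by (intro sect_cong) (auto simp: l_def)
      ultimately show ?thesis using that(4) unfolding \<N>_def
        by (auto intro!: image_eqI[of _ _ "(\<gamma>, A, l)"])
    qed
    then have "P f \<beta> y" unfolding P_def using y0 y by auto
    then show ?thesis by blast
  qed
  \<comment> \<open>The recursion is legitimate because \<open>P f \<beta>\<close> depends only on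
    the values of \<open>f\<close> below \<open>\<beta>\<close>.\<close>
  have "\<exists>f. \<forall>\<beta>. P f \<beta> (f \<beta>)"
  proof (rule dependent_wf_choice[OF wf])
    fix f g :: "(nat \<Rightarrow> bool) \<Rightarrow> nat \<Rightarrow> real" and \<beta> y
    assume "\<And>z. (z, \<beta>) \<in> R \<Longrightarrow> f z = g z"
    then have "((\<delta>, \<beta>) \<in> R \<and> (\<exists>j\<le>n. c = f \<delta> j)) = ((\<delta>, \<beta>) \<in> R \<and> (\<exists>j\<le>n. c = g \<delta> j))" for \<delta> c
      by auto
    then show "P f \<beta> y = P g \<beta> y" unfolding P_def by simp
  qed (rule exP)
  then obtain X where X: "\<And>\<beta>. P X \<beta> (X \<beta>)" by blast
  have main: "thin (sect (C \<gamma>) A (case_prod X \<circ> p))"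
    if \<gamma>: "thin (C \<gamma>)" and A: "A \<subseteq> {..<n}" "inj_on p A" "p ` A \<subseteq> (- {\<delta>. (\<delta>, \<gamma>) \<in> R}) \<times> {..n}" for \<gamma> A p
  proof -
    have "finite A" using A(1) finite_subset by blast
    then show ?thesis using A
    proof (induction rule: finite_psubset_induct)
      case (psubset A)
      show ?case
      proof (cases "A = {}")
        case False
        \<comment> \<open>The coordinate \<open>i0\<close> uses the latest block
          \<open>\<beta>\<close>, and \<open>B\<close> will be the set of all coordinates using it.
          Those in \<open>A - B\<close> use earlier blocks and are covered by the induction
          hypothesis; \<open>P\<close> at stage \<open>\<beta>\<close> then fixes those in
          \<open>B\<close> at once.\<close>
        then obtain i0 where i0: "i0 \<in> A" and i0_max: "\<And>i. i \<in> A \<Longrightarrow> (fst (p i), fst (p i0)) \<in> r"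
          using finite_total_max[OF tot trans refl, of "(fst \<circ> p) ` A"] psubset.hyps by auto
        define \<beta> where "\<beta> = fst (p i0)"
        define B where "B = {i \<in> A. fst (p i) = \<beta>}"
        let ?v = "case_prod X \<circ> p"
        have pA: "(fst (p i), \<gamma>) \<notin> R \<and> snd (p i) \<le> n" if "i \<in> A" for i
        proof -
          have "p i \<in> (- {\<delta>. (\<delta>, \<gamma>) \<in> R}) \<times> {..n}" using psubset.prems(3) that by auto
          then show ?thesis by (cases "p i") auto
        qed
        have "A - B \<subset> A" using i0 by (auto simp: B_def \<beta>_def)
        moreover have "A - B \<subseteq> {..<n}" "inj_on p (A - B)" "p ` (A - B) \<subseteq> (- {\<delta>. (\<delta>, \<gamma>) \<in> R}) \<times> {..n}"
          using psubset.prems by (auto intro: inj_on_subset)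
        ultimately have IH: "thin (sect (C \<gamma>) (A - B) ?v)" by (rule psubset.IH)
        \<comment> \<open>The blocks used do not precede \<open>\<gamma>\<close>, so the code
          \<open>\<gamma>\<close> was taken into account at stage \<open>\<beta>\<close>.\<close>
        have "(\<gamma>, \<beta>) \<in> r"
          using pA[OF i0] tot refl unfolding \<beta>_def R_def total_on_def refl_on_def
          by (cases "\<gamma> = fst (p i0)") auto
        moreover have "\<exists>\<delta>. (\<delta>, \<beta>) \<in> R \<and> (\<exists>j\<le>n. ?v i = X \<delta> j)" if "i \<in> A - B" for i
          using that i0_max[of i] pA[of i]
          by (intro exI[of _ "fst (p i)"]) (auto simp: B_def R_def \<beta>_def split: prod.splits)
        moreover have "inj_on (snd \<circ> p) B"
          using psubset.prems(2) by (auto simp: inj_on_def B_def prod_eq_iff)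
        moreover have "(snd \<circ> p) ` B \<subseteq> {..n}" using pA by (auto simp: B_def)
        moreover have "A - B \<subseteq> {..<n}" "B \<subseteq> {..<n}" using psubset.prems(1) by (auto simp: B_def)
        ultimately have "thin (sect (sect (C \<gamma>) (A - B) ?v) B (X \<beta> \<circ> (snd \<circ> p)))"
          using X[of \<beta>] IH unfolding P_def by blast
        moreover have "sect (sect (C \<gamma>) (A - B) ?v) B (X \<beta> \<circ> (snd \<circ> p)) = sect (C \<gamma>) A ?v"
        proof -
          have "A - B \<union> B = A" by (auto simp: B_def)
          moreover have "override_on (X \<beta> \<circ> (snd \<circ> p)) ?v (A - B) i = ?v i" if "i \<in> A" for i
            using that by (auto simp: override_on_def B_def split: prod.splits)
          then have "sect (C \<gamma>) A (override_on (X \<beta> \<circ> (snd \<circ> p)) ?v (A - B)) = sect (C \<gamma>) A ?v"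
            by (rule sect_cong)
          ultimately show ?thesis unfolding sect_sect by simp
        qed
        ultimately show ?thesis by (simp only:)
      qed (simp add: \<gamma>)
    qed
  qed
  have "\<exists>S. small S \<and> (\<forall>A p. A \<subseteq> {..<n} \<longrightarrow> inj_on p A \<longrightarrow>
      p ` A \<subseteq> (- S) \<times> {..n} \<longrightarrow> thin (sect N A (case_prod X \<circ> p)))" if N: "thin N" for N
  proof -
    obtain \<gamma> where \<gamma>: "N = C \<gamma>" using C N unfolding thin_def by blast
    show ?thesis unfolding \<gamma>
      by (intro exI[of _ "{\<delta>. (\<delta>, \<gamma>) \<in> R}"] conjI small_below allI impI main N[unfolded \<gamma>])
  qed
  moreover have "(\<Sum>k\<le>n. X \<beta> k) = 0" for \<beta> using X[of \<beta>] unfolding P_def by (rule conjunct1)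
  ultimately show ?thesis by (intro exI[of _ X] conjI allI impI)
qed

section \<open>Entangledness from genericity\<close>

text \<open>A line in the direction of coordinate 0 meets the diagonal in one point, and points are
  not open in a line. This serves to make the entries of the blocks pairwise distinct.\<close>

lemma thin_diagonal: "thin {x. x 0 = x (1::nat)}"
proof (rule thinI)
  show "closed {x :: nat \<Rightarrow> real. x 0 = x 1}"
    by (intro closed_Collect_eq continuous_on_product_coordinates)
  fix U :: "(nat \<Rightarrow> real) set" assume U: "open U" "U \<subseteq> {x. x 0 = x 1}"
  have "u \<notin> U" for u
  proof
    assume u: "u \<in> U"
    have "continuous_on UNIV (\<lambda>r. u(0 := r))"
    proof (rule continuous_on_coordinatewise_then_product)
      show "continuous_on UNIV (\<lambda>r. (u(0 := r)) i)" for i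
        by (cases "i = 0") auto
    qed
    then have "open ((\<lambda>r. u(0 := r)) -` U)" by (rule open_vimage[OF U(1)])
    moreover have "(\<lambda>r. u(0 := r)) -` U = {u 1}"
    proof
      show "(\<lambda>r. u(0 := r)) -` U \<subseteq> {u 1}"
      proof
        fix r assume "r \<in> (\<lambda>r. u(0 := r)) -` U"
        then have "u(0 := r) \<in> {x. x 0 = x 1}" using U(2) by auto
        then show "r \<in> {u 1}" by simp
      qed
      show "{u 1} \<subseteq> (\<lambda>r. u(0 := r)) -` U"
        using u U(2) by (auto simp: fun_upd_idem)
    qed
    ultimately show False using not_open_singleton by metis
  qed
  then show "U = {}" by blast
qed

lemma tuple_type_eq_iff:
  assumes "length e = m" "length e' = m" "length t = m"
  shows "tuple_type e e' = t \<longleftrightarrow> (\<forall>i<m. t ! i \<longleftrightarrow> e' ! i < e ! i)"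
  using assms by (auto simp: tuple_type_def list_eq_iff_nth_eq)

text \<open>\<open>V\<close> stands for the entries of early blocks. Disjoint tuples that meet
  \<open>V\<close> do so in different points, so continuum many of them cannot all meet the small
  set \<open>V\<close>.\<close>

lemma entangledI_generic:
  assumes n: "n > 0" and le: "continuum \<le>o |E|"
    and gen: "\<And>N. thin N \<Longrightarrow> \<exists>V. small V \<and>
      (\<forall>e. length e = n \<longrightarrow> distinct e \<longrightarrow> set e \<subseteq> E - V \<longrightarrow> thin (sect N {..<n} ((!) e)))"
  shows "entangled continuum n E"
  unfolding entangled_def
proof (intro conjI allI impI)
  fix F :: "real list set" and t :: "bool list"
  assume "|F| =o continuum \<and> (\<forall>e\<in>F. length e = n \<and> distinct e \<and> set e \<subseteq> E) \<and>
      pairwise (\<lambda>e e'. disjnt (set e) (set e')) F \<and> length t = n"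
  then have cF: "|F| =o continuum" and F: "\<And>e. e \<in> F \<Longrightarrow> length e = n \<and> distinct e \<and> set e \<subseteq> E"
    and dj: "pairwise (\<lambda>e e'. disjnt (set e) (set e')) F" and t: "length t = n" by auto
  \<comment> \<open>\<open>K\<close> is the closure of \<open>F\<close>, each tuple being replaced
    by the cylinder over it.\<close>
  define K where "K = closure {x. \<exists>e\<in>F. \<forall>i<n. x i = e ! i}"
  have "thin (K - interior K)" by (intro thin_frontier) (simp add: K_def)
  then obtain V where V: "small V" and gV: "\<And>e. length e = n \<Longrightarrow> distinct e \<Longrightarrow> set e \<subseteq> E - V \<Longrightarrow>
      thin (sect (K - interior K) {..<n} ((!) e))"
    using gen by blast
  have "\<exists>e\<in>F. set e \<inter> V = {}"
  proof (rule ccontr)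
    assume "\<not> ?thesis"
    then have "\<forall>e\<in>F. \<exists>v. v \<in> set e \<inter> V" by blast
    then obtain h where h: "\<And>e. e \<in> F \<Longrightarrow> h e \<in> set e \<inter> V" by metis
    have "inj_on h F"
    proof (rule inj_onI, rule ccontr)
      fix e e' assume *: "e \<in> F" "e' \<in> F" "h e = h e'" "e \<noteq> e'"
      then have "disjnt (set e) (set e')" using dj by (simp add: pairwise_def)
      then show False using h[OF *(1)] h[OF *(2)] *(3) by (auto simp: disjnt_iff)
    qed
    then have "|F| \<le>o |V|" using h by (intro card_of_ordLeqI) auto
    then have "|F| <o continuum" using V ordLeq_ordLess_trans by blast
    then show False using cF not_ordLess_ordIso by blast
  qed
  then obtain e where e: "e \<in> F" "set e \<inter> V = {}" by blast
  then have "thin (sect (K - interior K) {..<n} ((!) e))"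
    using F[OF e(1)] by (intro gV) auto
  \<comment> \<open>Some continuation \<open>y\<close> of \<open>e\<close> lies off the frontier of
    \<open>K\<close>; as \<open>y\<close> begins with \<open>e\<close>, it belongs to
    \<open>K\<close> and hence to its interior.\<close>
  then obtain x where "x \<notin> sect (K - interior K) {..<n} ((!) e)"
    using thin_ex_notin[of _ UNIV] by auto
  define y where "y = override_on x ((!) e) {..<n}"
  have y: "y i = e ! i" if "i < n" for i using that by (simp add: y_def)
  have "y \<in> K" unfolding K_def using y e(1) by (intro subsetD[OF closure_subset]) auto
  moreover have "y \<notin> K - interior K"
    using \<open>x \<notin> sect (K - interior K) {..<n} ((!) e)\<close> by (simp add: sect_def y_def)
  ultimately have yK: "y \<in> interior K" by blast
  \<comment> \<open>For small positive \<open>\<epsilon>\<close>, \<open>g \<epsilon>\<close> lies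
    in the orthant at \<open>y\<close> prescribed by \<open>t\<close> and still in the interior of
    \<open>K\<close>.\<close>
  define g where "g \<epsilon> i = (if i < n \<and> t ! i then y i - \<epsilon> else y i + \<epsilon>)" for \<epsilon> i
  have "continuous_on UNIV (\<lambda>\<epsilon>. g \<epsilon> i)" for i
    by (cases "i < n \<and> t ! i") (auto simp: g_def intro!: continuous_intros)
  then have "continuous_on UNIV g" by (rule continuous_on_coordinatewise_then_product)
  then have "open (g -` interior K)" by (rule open_vimage[OF open_interior])
  moreover have "g 0 = y" by (auto simp: g_def)
  then have "0 \<in> g -` interior K" using yK by simp
  ultimately obtain d where d: "d > 0" "ball 0 d \<subseteq> g -` interior K"
    by (rule openE)
  have "d / 2 \<in> ball 0 d" using d(1) by simp
  then have gK: "g (d / 2) \<in> interior K" using d(2) by blast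
  \<comment> \<open>The open orthant at \<open>y\<close> meets \<open>K\<close>, so it meets the
    cylinder over some \<open>e'\<close> in \<open>F\<close>.\<close>
  define O' where "O' = (\<Inter>i<n. {z. if t ! i then z i < y i else y i < z i})"
  have "open {z. if t ! i then z i < y i else y i < z i}" for i
    by (cases "t ! i") (auto intro!: open_Collect_less continuous_intros)
  then have "open O'" unfolding O'_def by (intro open_INT) auto
  moreover have "g (d / 2) \<in> O'" using d(1) by (auto simp: O'_def g_def)
  ultimately obtain z where "z \<in> O'" "z \<in> {x. \<exists>e\<in>F. \<forall>i<n. x i = e ! i}"
    using gK interior_subset[of K] open_Int_closure_eq_empty[of O' "{x. \<exists>e\<in>F. \<forall>i<n. x i = e ! i}"]
    unfolding K_def by auto
  then obtain e' where e': "e' \<in> F" "\<And>i. i < n \<Longrightarrow> z i = e' ! i" by auto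
  have cmp: "if t ! i then e' ! i < e ! i else e ! i < e' ! i" if "i < n" for i
  proof -
    have "z \<in> {z. if t ! i then z i < y i else y i < z i}"
      using \<open>z \<in> O'\<close> that unfolding O'_def by blast
    then show ?thesis by (simp add: e'(2)[OF that] y[OF that] split: if_splits)
  qed
  then have "tuple_type e e' = t"
    using F[OF e(1)] F[OF e'(1)] t by (subst tuple_type_eq_iff) (force split: if_splits)+
  moreover have "e \<noteq> e'" using cmp[OF n] by (auto split: if_splits)
  ultimately show "\<exists>e\<in>F. \<exists>e'\<in>F. e \<noteq> e' \<and> realizes e e' t"
    using e(1) e'(1) unfolding realizes_def by blast
qed (rule le)

section \<open>Failure of entangledness for \<open>n + 1\<close>\<close>

text \<open>The blocks themselves omit the constant type: realizing it would make one block smaller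
  than another in every coordinate, although both have sum 0.\<close>

lemma not_entangled_sum_zero:
  fixes X :: "'a \<Rightarrow> nat \<Rightarrow> real"
  assumes J: "|J| =o continuum" and sum0: "\<And>\<beta>. \<beta> \<in> J \<Longrightarrow> (\<Sum>k\<le>n. X \<beta> k) = 0"
    and inj: "inj_on (case_prod X) (J \<times> {..n})"
  shows "\<not> entangled continuum (n + 1) (case_prod X ` (J \<times> {..n}))"
proof
  let ?E = "case_prod X ` (J \<times> {..n})"
  define tup where "tup \<beta> = map (X \<beta>) [0..<n + 1]" for \<beta>
  have X_eq: "\<beta> = \<beta>' \<and> j = k" if "X \<beta> j = X \<beta>' k" "\<beta> \<in> J" "\<beta>' \<in> J" "j \<le> n" "k \<le> n" for \<beta> \<beta>' j k
    using inj_onD[OF inj, of "(\<beta>, j)" "(\<beta>', k)"] that by simp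
  have set_tup: "set (tup \<beta>) = X \<beta> ` {..n}" for \<beta>
    unfolding tup_def set_map set_upt by (simp add: atLeast0LessThan lessThan_Suc_atMost)
  have len: "length (tup \<beta>) = n + 1" for \<beta> by (simp add: tup_def)
  have nth: "tup \<beta> ! k = X \<beta> k" if "k < n + 1" for \<beta> k
    using that nth_upt[of 0 k "n + 1"] unfolding tup_def by (subst nth_map) (simp_all del: upt_Suc)
  have "bij_betw tup J (tup ` J)"
    by (intro inj_on_imp_bij_betw inj_onI) (metis X_eq nth zero_less_Suc Suc_eq_plus1 le0)
  then have "|J| =o |tup ` J|" by (rule card_of_ordIsoI)
  then have "|tup ` J| =o continuum" using J ordIso_symmetric ordIso_transitive by blast
  moreover have "\<forall>e\<in>tup ` J. length e = n + 1 \<and> distinct e \<and> set e \<subseteq> ?E"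
  proof (intro ballI conjI)
    fix e assume "e \<in> tup ` J"
    then obtain \<beta> where b: "\<beta> \<in> J" "e = tup \<beta>" by blast
    show "length e = n + 1" by (simp add: b len)
    show "distinct e" using X_eq[OF _ b(1) b(1)]
      by (auto simp: b(2) tup_def distinct_map inj_on_def simp del: upt_Suc)
    show "set e \<subseteq> ?E" using b(1) by (auto simp: b(2) set_tup)
  qed
  moreover have "pairwise (\<lambda>e e'. disjnt (set e) (set e')) (tup ` J)"
    using X_eq by (auto simp: pairwise_def disjnt_iff set_tup)
  moreover assume "entangled continuum (n + 1) ?E"
  ultimately obtain e e' where ee': "e \<in> tup ` J" "e' \<in> tup ` J" "e \<noteq> e'"
      "realizes e e' (replicate (n + 1) True)"
    unfolding entangled_def by (meson length_replicate)
  then obtain \<beta> \<beta>' where b: "\<beta> \<in> J" "\<beta>' \<in> J" "e = tup \<beta>" "e' = tup \<beta>'" "\<beta> \<noteq> \<beta>'" by auto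
  have no: False if "\<gamma> \<in> J" "\<gamma>' \<in> J" "\<And>k. k \<le> n \<Longrightarrow> X \<gamma> k < X \<gamma>' k" for \<gamma> \<gamma>'
  proof -
    have "(\<Sum>k\<le>n. X \<gamma> k) < (\<Sum>k\<le>n. X \<gamma>' k)" using that(3) by (intro sum_strict_mono) auto
    then show False using sum0 that(1,2) by simp
  qed
  have "(\<forall>k<n+1. X \<beta>' k < X \<beta> k) \<or> (\<forall>k<n+1. \<not> X \<beta>' k < X \<beta> k)"
  proof -
    have "tuple_type e e' = replicate (n + 1) True \<or> tuple_type e e' = replicate (n + 1) False"
      using ee'(4) unfolding realizes_def map_replicate by simp
    then show ?thesis
      unfolding b by (subst (asm) (1 2) tuple_type_eq_iff[of _ "n + 1"])
        (auto simp: len nth simp del: replicate_Suc)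
  qed
  then show False
  proof
    assume *: "\<forall>k<n+1. X \<beta>' k < X \<beta> k"
    show False by (rule no[OF b(2,1)]) (simp add: *)
  next
    \<comment> \<open>The negated type yields only weak inequalities; distinctness of the entries
      makes them strict.\<close>
    assume *: "\<forall>k<n+1. \<not> X \<beta>' k < X \<beta> k"
    show False
    proof (rule no[OF b(1,2)])
      fix k assume k: "k \<le> n"
      then have "X \<beta> k \<noteq> X \<beta>' k" using X_eq[of \<beta> k \<beta>' k] b by auto
      moreover have "\<not> X \<beta>' k < X \<beta> k" using * k by simp
      ultimately show "X \<beta> k < X \<beta>' k" by linarith
    qed
  qed
qed

section \<open>Selection of \<open>E\<close> from the generic blocks\<close>

theorem theorem3p1:
  assumes "cov_B =o continuum"
  shows "\<forall>n>1. \<exists>E :: real set. entangled continuum n E \<and> \<not> entangled continuum (n + 1) E"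
proof (intro allI impI)
  fix n :: nat assume n: "n > 1"
  obtain X :: "(nat \<Rightarrow> bool) \<Rightarrow> nat \<Rightarrow> real" where sum0: "\<And>\<beta>. (\<Sum>k\<le>n. X \<beta> k) = 0"
    and gen: "\<And>N. thin N \<Longrightarrow> \<exists>S. small S \<and> (\<forall>A p. A \<subseteq> {..<n} \<longrightarrow> inj_on p A \<longrightarrow>
      p ` A \<subseteq> (- S) \<times> {..n} \<longrightarrow> thin (sect N A (case_prod X \<circ> p)))"
    using ex_generic_family[OF assms, of n] by auto
  \<comment> \<open>Outside a small set \<open>S0\<close> of indices the blocks are generic over the
    diagonal, which separates their entries.\<close>
  obtain S0 where S0: "small S0" and gS0: "\<And>A p. A \<subseteq> {..<n} \<Longrightarrow> inj_on p A \<Longrightarrow>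
      p ` A \<subseteq> (- S0) \<times> {..n} \<Longrightarrow> thin (sect {x. x 0 = x 1} A (case_prod X \<circ> p))"
    using gen[OF thin_diagonal] by auto
  define J where "J = - S0"
  have inj: "inj_on (case_prod X) (J \<times> {..n})"
  proof (rule inj_onI, rule ccontr)
    fix a b assume ab: "a \<in> J \<times> {..n}" "b \<in> J \<times> {..n}" "case_prod X a = case_prod X b" "a \<noteq> b"
    define p where "p i = (if i = 0 then a else b)" for i :: nat
    \<comment> \<open>The coordinates 0 and 1 both lie below \<open>n\<close> because
      \<open>n > 1\<close>.\<close>
    have "thin (sect {x. x 0 = x 1} {0, 1} (case_prod X \<circ> p))"
      using ab n by (intro gS0) (auto simp: p_def J_def inj_on_def)
    then obtain x where "x \<notin> sect {x. x 0 = x 1} {0, 1} (case_prod X \<circ> p)"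
      using thin_ex_notin[of _ UNIV] by auto
    then show False using ab(3) by (simp add: sect_def override_on_def p_def)
  qed
  have "\<not> small J"
  proof
    assume "small J"
    then have "small (J \<union> S0)" using S0 by (rule small_Un)
    then show False by (simp add: J_def continuum_eq ordLess_irreflexive)
  qed
  then have cJ: "continuum \<le>o |J|"
    unfolding continuum_eq by (simp add: card_of_Well_order not_ordLess_iff_ordLeq)
  moreover have "|J| \<le>o continuum" unfolding continuum_eq by (rule card_of_mono1) simp
  ultimately have J: "|J| =o continuum" by (simp add: ordIso_iff_ordLeq)
  define E where "E = case_prod X ` (J \<times> {..n})"
  have "entangled continuum n E"
  proof (rule entangledI_generic)
    have "inj_on (\<lambda>\<beta>. X \<beta> 0) J" "(\<lambda>\<beta>. X \<beta> 0) ` J \<subseteq> E"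
      using inj by (auto simp: inj_on_def E_def)
    then have "|J| \<le>o |E|" by (intro card_of_ordLeqI) auto
    then show "continuum \<le>o |E|" using cJ ordLeq_transitive by blast
  next
    fix N assume "thin N"
    then obtain S where S: "small S" and gS: "\<And>A p. A \<subseteq> {..<n} \<Longrightarrow> inj_on p A \<Longrightarrow>
        p ` A \<subseteq> (- S) \<times> {..n} \<Longrightarrow> thin (sect N A (case_prod X \<circ> p))"
      using gen[of N] by auto
    \<comment> \<open>An entry of \<open>E\<close> outside \<open>V\<close> comes from a block with
      index outside \<open>S\<close>, that is, from one generic for \<open>N\<close>.\<close>
    define V where "V = case_prod X ` (S \<times> {..n})"
    have "thin (sect N {..<n} ((!) e))" if e: "length e = n" "distinct e" "set e \<subseteq> E - V" for e
    proof -
      have "\<forall>i<n. \<exists>a. a \<in> (- S) \<times> {..n} \<and> case_prod X a = e ! i"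
      proof (intro allI impI)
        fix i assume "i < n"
        then have "e ! i \<in> E - V" using e(1,3) nth_mem[of i e] by blast
        then obtain \<beta> k where bk: "e ! i = X \<beta> k" "k \<le> n" "X \<beta> k \<notin> V" by (auto simp: E_def)
        then have "\<beta> \<notin> S" unfolding V_def by (auto simp: image_iff)
        with bk show "\<exists>a. a \<in> (- S) \<times> {..n} \<and> case_prod X a = e ! i" by (intro exI[of _ "(\<beta>, k)"]) auto
      qed
      then obtain p where p: "\<And>i. i < n \<Longrightarrow> p i \<in> (- S) \<times> {..n} \<and> case_prod X (p i) = e ! i" by metis
      have "inj_on p {..<n}"
      proof (rule inj_onI)
        fix i j assume ij: "i \<in> {..<n}" "j \<in> {..<n}" "p i = p j"
        then have "e ! i = e ! j" using p[of i] p[of j] by simp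
        then show "i = j" using ij e(1,2) by (simp add: nth_eq_iff_index_eq)
      qed
      moreover have "p ` {..<n} \<subseteq> (- S) \<times> {..n}" using p by blast
      ultimately have "thin (sect N {..<n} (case_prod X \<circ> p))" by (intro gS) auto
      moreover have "sect N {..<n} (case_prod X \<circ> p) = sect N {..<n} ((!) e)"
        using p by (intro sect_cong) auto
      ultimately show ?thesis by (simp only:)
    qed
    moreover have "small V" unfolding V_def by (intro small_image small_Times S small_finite) auto
    ultimately show "\<exists>V. small V \<and> (\<forall>e. length e = n \<longrightarrow> distinct e \<longrightarrow> set e \<subseteq> E - V \<longrightarrow>
        thin (sect N {..<n} ((!) e)))"
      by (intro exI[of _ V] conjI allI impI)
  qed (use n in simp)
  moreover have "\<not> entangled continuum (n + 1) E"
    unfolding E_def by (rule not_entangled_sum_zero[OF J sum0 inj])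
  ultimately show "\<exists>E. entangled continuum n E \<and> \<not> entangled continuum (n + 1) E" by blast
qed

end
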